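(* For every positive integer $n$, the complete graph $K_n$ satisfies: (1) $K_n\in\mathfrak{T}$; (2) $w_\tau(K_n)=n$ if $n$ is odd, and $w_\tau(K_n)=\frac{3}{2}n$ if $n$ is even; (3) $W_\tau(K_n)=2n-1$.
   Context: All graphs are finite, undirected, without loops or multiple edges. A total coloring of a graph $G$ is an assignment of colors to the vertices and edges of $G$ such that no two adjacent vertices, no two adjacent edges, and no vertex and an edge incident to it receive the same color. For a positive integer $t$, an interval total $t$-coloring of $G$ is a total coloring of $G$ with colors $1,2,\ldots,t$ such that each color $i\in\{1,\ldots,t\}$ is used on at least one vertex or edge, and for each vertex $v$ the set consisting of the color of $v$ and the colors of the edges incident to $v$ consists of $d_G(v)+1$ consecutive integers, where $d_G(v)$ is the degree of $v$. $\mathfrak{T}_t$ denotes the set of graphs having an interval total $t$-coloring, and $\mathfrak{T}=\bigcup_{t\geq 1}\mathfrak{T}_t$. For $G\in\mathfrak{T}$, $w_\tau(G)$ and $W_\tau(G)$ denote the least and the greatest $t$ such that $G\in\mathfrak{T}_t$. *)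

theory Defs
  imports Complex_Main
begin

record 'a graph =
  verts :: "'a set"
  edges :: "'a set set"

definition simple_graph :: "'a graph \<Rightarrow> bool" where
  "simple_graph G \<longleftrightarrow> finite (verts G) \<and> (\<forall>e \<in> edges G. e \<subseteq> verts G \<and> card e = 2)"

definition degree :: "'a graph \<Rightarrow> 'a \<Rightarrow> nat" where
  "degree G v = card {e \<in> edges G. v \<in> e}"

text \<open>A coloring is a single function on the disjoint sum of vertices (\<open>Inl\<close>) and edges (\<open>Inr\<close>).
  Its values outside the elements of the graph are irrelevant.\<close>

definition elements :: "'a graph \<Rightarrow> ('a + 'a set) set" where
  "elements G = Inl ` verts G \<union> Inr ` edges G"

definition total_coloring :: "'a graph \<Rightarrow> ('a + 'a set \<Rightarrow> nat) \<Rightarrow> bool" where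
  "total_coloring G c \<longleftrightarrow>
     (\<forall>u \<in> verts G. \<forall>v \<in> verts G. {u, v} \<in> edges G \<longrightarrow> c (Inl u) \<noteq> c (Inl v)) \<and>
     (\<forall>e \<in> edges G. \<forall>e' \<in> edges G. e \<noteq> e' \<and> e \<inter> e' \<noteq> {} \<longrightarrow> c (Inr e) \<noteq> c (Inr e')) \<and>
     (\<forall>v \<in> verts G. \<forall>e \<in> edges G. v \<in> e \<longrightarrow> c (Inl v) \<noteq> c (Inr e))"

definition spectrum :: "'a graph \<Rightarrow> ('a + 'a set \<Rightarrow> nat) \<Rightarrow> 'a \<Rightarrow> nat set" where
  "spectrum G c v = insert (c (Inl v)) {c (Inr e) | e. e \<in> edges G \<and> v \<in> e}"

text \<open>The interval \<open>{k..k + d}\<close> below consists of \<open>d + 1\<close> consecutive integers.\<close>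

definition interval_total_coloring :: "'a graph \<Rightarrow> nat \<Rightarrow> ('a + 'a set \<Rightarrow> nat) \<Rightarrow> bool" where
  "interval_total_coloring G t c \<longleftrightarrow>
     total_coloring G c \<and>
     (\<forall>x \<in> elements G. c x \<in> {1..t}) \<and>
     (\<forall>i \<in> {1..t}. \<exists>x \<in> elements G. c x = i) \<and>
     (\<forall>v \<in> verts G. \<exists>k. spectrum G c v = {k..k + degree G v})"

definition interval_total_colorable_with :: "nat \<Rightarrow> 'a graph set" where
  "interval_total_colorable_with t = {G. simple_graph G \<and> (\<exists>c. interval_total_coloring G t c)}"

definition interval_total_colorable :: "'a graph set" where
  "interval_total_colorable = (\<Union>t \<in> {1..}. interval_total_colorable_with t)"

definition w_tau :: "'a graph \<Rightarrow> nat" where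
  "w_tau G = (LEAST t. t \<ge> 1 \<and> G \<in> interval_total_colorable_with t)"

definition W_tau :: "'a graph \<Rightarrow> nat" where
  "W_tau G = (GREATEST t. t \<ge> 1 \<and> G \<in> interval_total_colorable_with t)"

definition complete_graph :: "'a set \<Rightarrow> 'a graph" where
  "complete_graph V = \<lparr>verts = V, edges = {{u, v} | u v. u \<in> V \<and> v \<in> V \<and> u \<noteq> v}\<rparr>"

end

theory Submission
  imports Defs
begin

text \<open>A total coloring of \<open>K\<^sub>n\<close> is a symmetric \<open>n \<times> n\<close> matrix with injective rows and injective
  diagonal (the vertex colors); it is an interval coloring if every row fills an interval of length
  \<open>n\<close>. A color in row \<open>u\<close> at column \<open>v\<close> is within \<open>n - 1\<close> of all colors of row \<open>u\<close> and of all
  colors of row \<open>v\<close>, so at most \<open>2n - 1\<close> colors occur, and \<open>i + j + 1\<close> (with \<open>i, j < n\<close>) attains this.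
  If \<open>n\<close> is odd, \<open>(i + j) mod n + 1\<close> uses \<open>n\<close> colors. If \<open>n\<close> is even, a color occurring in every row
  forms a perfect matching, since a vertex of this color would leave an odd number of vertices to be
  matched. The colors \<open>t - n + 1, \<dots>, n\<close> occur in every row, so the \<open>n\<close> distinct vertex colors lie
  among the other \<open>2(t - n)\<close> ones, which gives \<open>t \<ge> 3n/2\<close>.\<close>

section \<open>Colorings of complete graphs as matrices\<close>

definition color_matrix :: "('a + 'a set \<Rightarrow> nat) \<Rightarrow> 'a \<Rightarrow> 'a \<Rightarrow> nat" where
  "color_matrix c u v = (if u = v then c (Inl u) else c (Inr {u, v}))"

lemma color_matrix_commute: "color_matrix c u v = color_matrix c v u"
  by (simp add: color_matrix_def insert_commute)

lemma verts_complete_graph [simp]: "verts (complete_graph V) = V"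
  by (simp add: complete_graph_def)

lemma edges_complete_graph:
  "edges (complete_graph V) = {{u, v} | u v. u \<in> V \<and> v \<in> V \<and> u \<noteq> v}"
  by (simp add: complete_graph_def)

lemma edge_complete_graph_iff:
  "{u, v} \<in> edges (complete_graph V) \<longleftrightarrow> u \<in> V \<and> v \<in> V \<and> u \<noteq> v"
  by (auto simp: edges_complete_graph doubleton_eq_iff)

lemma incident_edges_complete_graph:
  assumes "v \<in> V"
  shows "{e \<in> edges (complete_graph V). v \<in> e} = (\<lambda>u. {v, u}) ` (V - {v})"
  using assms by (auto simp: edges_complete_graph)

lemma incident_edge_complete_graphE:
  assumes "e \<in> edges (complete_graph V)" "v \<in> e"
  obtains u where "e = {v, u}" "u \<in> V" "u \<noteq> v"
  using assms by (auto simp: edges_complete_graph)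

lemma simple_complete_graph: "finite V \<Longrightarrow> simple_graph (complete_graph V)"
  by (auto simp: simple_graph_def edges_complete_graph)

lemma degree_complete_graph:
  assumes "v \<in> V"
  shows "degree (complete_graph V) v = card V - 1"
proof -
  have "inj_on (\<lambda>u. {v, u}) (V - {v})"
    by (auto simp: inj_on_def doubleton_eq_iff)
  then show ?thesis
    using assms by (simp add: degree_def incident_edges_complete_graph card_image)
qed

lemma spectrum_complete_graph:
  assumes "v \<in> V"
  shows "spectrum (complete_graph V) c v = color_matrix c v ` V"
proof -
  have "spectrum (complete_graph V) c v =
      insert (c (Inl v)) ((\<lambda>e. c (Inr e)) ` {e \<in> edges (complete_graph V). v \<in> e})"
    by (auto simp: spectrum_def)
  also have "\<dots> = insert (color_matrix c v v) (color_matrix c v ` (V - {v}))"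
    unfolding incident_edges_complete_graph[OF assms] image_image
    by (intro arg_cong2[where f = insert] image_cong) (auto simp: color_matrix_def)
  also have "\<dots> = color_matrix c v ` V"
    using assms by blast
  finally show ?thesis .
qed

lemma total_coloring_edges:
  assumes "total_coloring G c" "e \<in> edges G" "e' \<in> edges G" "e \<noteq> e'" "e \<inter> e' \<noteq> {}"
  shows "c (Inr e) \<noteq> c (Inr e')"
  using assms by (simp add: total_coloring_def)

lemma total_coloring_vertex_edge:
  assumes "total_coloring G c" "v \<in> verts G" "e \<in> edges G" "v \<in> e"
  shows "c (Inl v) \<noteq> c (Inr e)"
  using assms by (simp add: total_coloring_def)

text \<open>Row \<open>v\<close> holds the color of \<open>v\<close> on the diagonal and the colors
  of the edges at \<open>v\<close> elsewhere, so its injectivity covers both edge-edge and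
  vertex-edge conflicts at \<open>v\<close>. Any two vertices are adjacent, which accounts for the
  diagonal.\<close>

lemma total_coloring_complete_graph_iff:
  "total_coloring (complete_graph V) c \<longleftrightarrow>
     inj_on (\<lambda>v. color_matrix c v v) V \<and> (\<forall>v \<in> V. inj_on (color_matrix c v) V)"
  (is "?L \<longleftrightarrow> ?D \<and> ?R")
proof (intro iffI conjI ballI)
  assume L: ?L
  then show ?D
    by (auto simp: total_coloring_def inj_on_def color_matrix_def edge_complete_graph_iff)
  fix v assume v: "v \<in> V"
  show "inj_on (color_matrix c v) V"
  proof (rule inj_onI, rule ccontr)
    fix x y assume xy: "x \<in> V" "y \<in> V" "color_matrix c v x = color_matrix c v y" "x \<noteq> y"
    have ve: "c (Inl v) \<noteq> c (Inr {v, z})" if "z \<in> V" "z \<noteq> v" for z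
      using L v that by (auto simp: total_coloring_def edge_complete_graph_iff)
    have ee: "c (Inr {v, x}) \<noteq> c (Inr {v, y})" if "x \<noteq> v" "y \<noteq> v"
    proof -
      have "{v, x} \<in> edges (complete_graph V)" "{v, y} \<in> edges (complete_graph V)"
        "{v, x} \<noteq> {v, y}" "{v, x} \<inter> {v, y} \<noteq> {}"
        using that v xy by (auto simp: edge_complete_graph_iff doubleton_eq_iff)
      then show ?thesis
        using total_coloring_edges[OF L] by simp
    qed
    show False
      using xy ve[of x] ve[of y] ee by (auto simp: color_matrix_def split: if_splits)
  qed
next
  assume DR: "?D \<and> ?R"
  show ?L
    unfolding total_coloring_def verts_complete_graph
  proof (intro conjI ballI impI)
    fix u v assume "u \<in> V" "v \<in> V" "{u, v} \<in> edges (complete_graph V)"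
    then have "u \<noteq> v" "color_matrix c u u = color_matrix c v v \<longrightarrow> u = v"
      using DR unfolding edge_complete_graph_iff inj_on_def by blast+
    then show "c (Inl u) \<noteq> c (Inl v)"
      by (simp add: color_matrix_def)
  next
    fix e e' assume e: "e \<in> edges (complete_graph V)" "e' \<in> edges (complete_graph V)"
      "e \<noteq> e' \<and> e \<inter> e' \<noteq> {}"
    then obtain v where v: "v \<in> e" "v \<in> e'" "v \<in> V"
      by (auto simp: edges_complete_graph)
    obtain x where "e = {v, x}" "x \<in> V" "x \<noteq> v"
      using e(1) v(1) by (rule incident_edge_complete_graphE)
    moreover obtain y where "e' = {v, y}" "y \<in> V" "y \<noteq> v"
      using e(2) v(2) by (rule incident_edge_complete_graphE)
    ultimately show "c (Inr e) \<noteq> c (Inr e')"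
      using DR v e unfolding inj_on_def color_matrix_def by metis
  next
    fix v e assume v: "v \<in> V" and e: "e \<in> edges (complete_graph V)" "v \<in> e"
    obtain x where "e = {v, x}" "x \<in> V" "x \<noteq> v"
      using e by (rule incident_edge_complete_graphE)
    then show "c (Inl v) \<noteq> c (Inr e)"
      using DR v unfolding inj_on_def color_matrix_def by metis
  qed
qed

lemma colors_complete_graph:
  "c ` elements (complete_graph V) = (\<Union>v \<in> V. color_matrix c v ` V)"
proof (intro equalityI subsetI)
  fix a assume "a \<in> c ` elements (complete_graph V)"
  then consider v where "v \<in> V" "a = c (Inl v)"
    | u v where "u \<in> V" "v \<in> V" "u \<noteq> v" "a = c (Inr {u, v})"
    by (auto simp: elements_def edges_complete_graph)
  then show "a \<in> (\<Union>v \<in> V. color_matrix c v ` V)"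
    by cases (force simp: color_matrix_def)+
next
  fix a assume "a \<in> (\<Union>v \<in> V. color_matrix c v ` V)"
  then show "a \<in> c ` elements (complete_graph V)"
    by (auto simp: color_matrix_def elements_def edge_complete_graph_iff)
qed

lemma interval_total_coloring_complete_graph_iff:
  "interval_total_coloring (complete_graph V) t c \<longleftrightarrow>
     inj_on (\<lambda>v. color_matrix c v v) V \<and>
     (\<forall>v \<in> V. inj_on (color_matrix c v) V) \<and>
     (\<Union>v \<in> V. color_matrix c v ` V) = {1..t} \<and>
     (\<forall>v \<in> V. \<exists>k. color_matrix c v ` V = {k..k + (card V - 1)})"
proof -
  have *: "(\<forall>x \<in> elements (complete_graph V). c x \<in> {1..t}) \<and>
      (\<forall>i \<in> {1..t}. \<exists>x \<in> elements (complete_graph V). c x = i) \<longleftrightarrow>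
      c ` elements (complete_graph V) = {1..t}"
    unfolding set_eq_iff image_iff by metis
  have "interval_total_coloring (complete_graph V) t c \<longleftrightarrow>
      total_coloring (complete_graph V) c \<and> c ` elements (complete_graph V) = {1..t} \<and>
      (\<forall>v \<in> V. \<exists>k. color_matrix c v ` V = {k..k + (card V - 1)})"
    unfolding interval_total_coloring_def *[symmetric]
    by (simp add: spectrum_complete_graph degree_complete_graph)
  then show ?thesis
    unfolding total_coloring_complete_graph_iff colors_complete_graph by blast
qed

section \<open>Constructions from explicit matrices\<close>

text \<open>Reduces each construction to arithmetic on indices below \<open>n\<close>. Inclusion of
  a row in an interval of length \<open>n\<close> suffices: an injective row has \<open>n\<close>
  values and so fills it.\<close>

lemma interval_total_coloring_from_matrix:
  fixes f :: "nat \<Rightarrow> nat \<Rightarrow> nat"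
  assumes "finite V" "card V = n" "n \<ge> 1"
    and commute: "\<And>i j. f i j = f j i"
    and diag: "inj_on (\<lambda>i. f i i) {..<n}"
    and rows: "\<And>i. i < n \<Longrightarrow> inj_on (f i) {..<n}"
    and range: "\<And>i. i < n \<Longrightarrow> f i ` {..<n} \<subseteq> {k i..k i + (n - 1)}"
    and colors: "(\<Union>i<n. f i ` {..<n}) = {1..t}"
  shows "complete_graph V \<in> interval_total_colorable_with t"
proof -
  obtain h where h: "bij_betw h V {..<n}"
    using ex_bij_betw_finite_nat[OF \<open>finite V\<close>] \<open>card V = n\<close> by (auto simp: lessThan_atLeast0)
  then have hV: "h ` V = {..<n}" and inj_h: "inj_on h V"
    by (auto simp: bij_betw_def)
  define c where
    \<comment> \<open>An edge is an unordered set; \<open>Min\<close> and \<open>Max\<close> recover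
      the indices of its ends, and symmetry of \<open>f\<close> makes their order
      irrelevant.\<close>
    "c = case_sum (\<lambda>v. f (h v) (h v)) (\<lambda>e. f (Min (h ` e)) (Max (h ` e)))"
  have c: "color_matrix c u v = f (h u) (h v)" for u v
    using commute by (auto simp: color_matrix_def c_def min_def max_def)
  have row: "color_matrix c v ` V = f (h v) ` {..<n}" for v
    unfolding hV[symmetric] image_image by (simp add: c)
  have "f i ` {..<n} = {k i..k i + (n - 1)}" if "i < n" for i
    using range[OF that] card_image[OF rows[OF that]] \<open>n \<ge> 1\<close>
    by (intro card_subset_eq) auto
  moreover have "inj_on (\<lambda>v. color_matrix c v v) V"
    using comp_inj_on[OF inj_h diag[folded hV]] by (simp add: c o_def)
  moreover have "inj_on (color_matrix c v) V" if "v \<in> V" for v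
    using comp_inj_on[OF inj_h, of "f (h v)"] rows[of "h v"] that hV by (auto simp: c o_def inj_on_def)
  moreover have "(\<Union>v \<in> V. color_matrix c v ` V) = {1..t}"
    unfolding colors[symmetric] row hV[symmetric] by (simp add: image_image)
  moreover have "h v < n" if "v \<in> V" for v
    using that hV by auto
  ultimately have "interval_total_coloring (complete_graph V) t c"
    unfolding interval_total_coloring_complete_graph_iff row
    using \<open>card V = n\<close> by blast
  then show ?thesis
    using simple_complete_graph[OF \<open>finite V\<close>] by (auto simp: interval_total_colorable_with_def)
qed

lemma complete_graph_colorable_max:
  assumes "finite V" "card V = n" "n \<ge> 1"
  shows "complete_graph V \<in> interval_total_colorable_with (2 * n - 1)"
proof (rule interval_total_coloring_from_matrix[OF assms, where f = "\<lambda>i j. i + j + 1" and k = Suc])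
  show "(\<Union>i<n. (\<lambda>j. i + j + 1) ` {..<n}) = {1..2 * n - 1}"
  proof (intro equalityI subsetI)
    fix a assume a: "a \<in> {1..2 * n - 1}"
    \<comment> \<open>Put as much of \<open>a - 1\<close> as possible into the row index; the
      remainder is the column.\<close>
    define i where "i = min (a - 1) (n - 1)"
    have "i < n" "a - 1 - i < n" "a = i + (a - 1 - i) + 1"
      using a \<open>n \<ge> 1\<close> by (auto simp: i_def)
    then show "a \<in> (\<Union>i<n. (\<lambda>j. i + j + 1) ` {..<n})"
      by blast
  qed auto
qed (auto simp: inj_on_def)

text \<open>Oddness is needed only on the diagonal: doubling is injective modulo an odd
  \<open>n\<close>.\<close>

lemma complete_graph_colorable_odd:
  assumes "finite V" "card V = n" "odd n"
  shows "complete_graph V \<in> interval_total_colorable_with n"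
proof -
  have n: "n \<ge> 1"
    using \<open>odd n\<close> by (cases n) auto
  have mod: "x mod n = (if x < n then x else x - n)" if "x < 2 * n" for x
    using that by (simp add: le_mod_geq)
  show ?thesis
  proof (rule interval_total_coloring_from_matrix[OF assms(1,2) n,
        where f = "\<lambda>i j. (i + j) mod n + 1" and k = "\<lambda>_. 1"])
    show "inj_on (\<lambda>i. (i + i) mod n + 1) {..<n}"
    proof (rule inj_onI)
      fix i j assume "i \<in> {..<n}" "j \<in> {..<n}" "(i + i) mod n + 1 = (j + j) mod n + 1"
      then show "i = j"
        using \<open>odd n\<close> by (simp add: mod split: if_splits) presburger+
    qed
    show "inj_on (\<lambda>j. (i + j) mod n + 1) {..<n}" if "i < n" for i
      using that by (auto simp: inj_on_def mod split: if_splits)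
    show "(\<Union>i<n. (\<lambda>j. (i + j) mod n + 1) ` {..<n}) = {1..n}"
    proof (intro equalityI subsetI)
      fix a assume a: "a \<in> {1..n}"
      then have "0 < n" "a - 1 < n" "a = (0 + (a - 1)) mod n + 1"
        by auto
      then show "a \<in> (\<Union>i<n. (\<lambda>j. (i + j) mod n + 1) ` {..<n})"
        by blast
    qed (use n in \<open>auto simp: Suc_le_eq\<close>)
  qed (use n in \<open>auto simp: add.commute less_Suc_eq_le[symmetric]\<close>)
qed

text \<open>The matrix is \<open>(i + j) mod n\<close> with the even residues renamed to \<open>1, \<dots>, n/2\<close> and the odd ones
  to \<open>n/2 + 1, \<dots>, n\<close>, the former being shifted by \<open>n\<close> in the rows which start after them.\<close>

lemma complete_graph_colorable_even:
  assumes "finite V" "card V = 2 * m" "m \<ge> 1"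
  shows "complete_graph V \<in> interval_total_colorable_with (3 * m)"
proof -
  define f :: "nat \<Rightarrow> nat \<Rightarrow> nat" where
    \<comment> \<open>Let \<open>p = (i + j) div 2\<close>. An odd sum below \<open>2 * m\<close>
      gets \<open>p + 1 + m\<close> by the renaming. From \<open>2 * m\<close> on, the residue has
      half \<open>p - m\<close>: an odd one gets \<open>(p - m) + 1 + m = p + 1\<close>, an even one
      \<open>(p - m) + 1 + 2 * m\<close> by the shift.\<close>
    "f i j = (i + j) div 2 + 1 + (if (i + j) div 2 < m \<longleftrightarrow> even (i + j) then 0 else m)" for i j
  have n: "2 * m \<ge> 1"
    using assms by simp
  have f_even: "f i j = (if p < m then p + 1 else p + m + 1)" if "i + j = 2 * p" for i j p
    using that by (simp add: f_def)
  have f_odd: "f i j = (if p < m then p + m + 1 else p + 1)" if "i + j = 2 * p + 1" for i j p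
    using that by (simp add: f_def)
  have parity: "\<exists>p. x = 2 * p \<or> x = 2 * p + 1" for x :: nat
    by presburger
  \<comment> \<open>\<open>Suc i div 2\<close> is i/2 rounded up, the number of even residues below
    \<open>i\<close>. Exactly their colors are shifted in row \<open>i\<close>, so the row starts
    just above them.\<close>
  have bounds: "Suc i div 2 + 1 \<le> f i j \<and> f i j \<le> Suc i div 2 + 2 * m"
    if "i < 2 * m" "j < 2 * m" for i j
  proof -
    define q where "q = Suc i div 2"
    have "2 * q \<le> i + 1" "i \<le> 2 * q"
      by (auto simp: q_def)
    moreover obtain p where "i + j = 2 * p \<or> i + j = 2 * p + 1"
      using parity by blast
    ultimately show ?thesis
      using that f_even[of i j p] f_odd[of i j p] unfolding q_def[symmetric]
      by (cases "p < m") (elim disjE; simp; linarith)+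
  qed
  \<comment> \<open>As a function of the sum of the indices, \<open>f\<close> repeats a value only
    at two odd sums differing by \<open>2 * m\<close>; sums within one row differ by less.\<close>
  have inj: "j = j'" if "i < 2 * m" "j < 2 * m" "j' < 2 * m" "f i j = f i j'" for i j j'
  proof -
    obtain p p' where "i + j = 2 * p \<or> i + j = 2 * p + 1" "i + j' = 2 * p' \<or> i + j' = 2 * p' + 1"
      using parity by meson
    then show ?thesis
      using that f_even[of i j p] f_odd[of i j p] f_even[of i j' p'] f_odd[of i j' p']
      by (cases "p < m"; cases "p' < m") (elim disjE; simp; linarith)+
  qed
  show ?thesis
  proof (rule interval_total_coloring_from_matrix[OF assms(1,2) n,
        where f = f and k = "\<lambda>i. Suc i div 2 + 1"])
    show "f i j = f j i" for i j
      by (simp add: f_def add.commute)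
    show "inj_on (\<lambda>i. f i i) {..<2 * m}"
      by (auto simp: f_def inj_on_def split: if_splits)
    show "inj_on (f i) {..<2 * m}" if "i < 2 * m" for i
      using inj[OF that] by (auto simp: inj_on_def)
    show "f i ` {..<2 * m} \<subseteq> {Suc i div 2 + 1..Suc i div 2 + 1 + (2 * m - 1)}" if "i < 2 * m" for i
      using bounds[OF that] n by fastforce
    show "(\<Union>i<2 * m. f i ` {..<2 * m}) = {1..3 * m}"
    proof (intro equalityI subsetI)
      fix a assume "a \<in> (\<Union>i<2 * m. f i ` {..<2 * m})"
      then obtain i j where ij: "i < 2 * m" "j < 2 * m" "a = f i j"
        by auto
      have "Suc i div 2 \<le> m"
        using ij by simp
      then show "a \<in> {1..3 * m}"
        using bounds[OF ij(1,2)] ij(3) by simp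
    next
      fix a assume a: "a \<in> {1..3 * m}"
      have "\<exists>i<2 * m. \<exists>j<2 * m. a = f i j"
      proof -
        \<comment> \<open>The diagonal supplies the lowest \<open>m\<close> and the highest
          \<open>m\<close> colors, the odd columns of row 0 the middle ones.\<close>
        consider "a \<le> m" | "m < a" "a \<le> 2 * m" | "2 * m < a"
          by linarith
        then show ?thesis
        proof cases
          case 1
          then have "a - 1 < 2 * m" "a = f (a - 1) (a - 1)"
            using a by (auto simp: f_def)
          then show ?thesis by blast
        next
          case 2
          define p where "p = a - m - 1"
          have "p < m" "a = p + 1 + m"
            using 2 by (auto simp: p_def)
          then have "0 < 2 * m" "2 * p + 1 < 2 * m" "a = f 0 (2 * p + 1)"
            by (auto simp: f_def)
          then show ?thesis by blast
        next
          case 3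
          then have "a - m - 1 < 2 * m" "a = f (a - m - 1) (a - m - 1)"
            using a by (auto simp: f_def)
          then show ?thesis by blast
        qed
      qed
      then show "a \<in> (\<Union>i<2 * m. f i ` {..<2 * m})"
        by auto
    qed
  qed
qed

section \<open>Bounds on the number of colors\<close>

lemma card_complete_graph_le_colors:
  assumes "finite V" "V \<noteq> {}" "interval_total_coloring (complete_graph V) t c"
  shows "card V \<le> t"
proof -
  obtain v where v: "v \<in> V"
    using \<open>V \<noteq> {}\<close> by blast
  have "color_matrix c v ` V \<subseteq> {1..t}" "inj_on (color_matrix c v) V"
    using assms(3) v unfolding interval_total_coloring_complete_graph_iff by blast+
  then have "card V \<le> card {1..t}"
    by (intro card_inj_on_le) auto
  then show ?thesis by simp
qed

lemma complete_graph_colors_le: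
  assumes "finite V" "V \<noteq> {}" "interval_total_coloring (complete_graph V) t c"
  shows "t \<le> 2 * card V - 1"
proof -
  define g where "g = color_matrix c"
  have colors: "(\<Union>v \<in> V. g v ` V) = {1..t}"
    and rows: "\<And>v. v \<in> V \<Longrightarrow> \<exists>k. g v ` V = {k..k + (card V - 1)}"
    using assms(3) unfolding interval_total_coloring_complete_graph_iff g_def by auto
  have close: "a \<le> b + (card V - 1)" if "v \<in> V" "a \<in> g v ` V" "b \<in> g v ` V" for v a b
    using rows[OF that(1)] that(2,3) by (metis add_le_mono1 atLeastAtMost_iff le_trans)
  have n: "card V > 0"
    using assms by (simp add: card_gt_0_iff)
  moreover have "t \<ge> 1"
    using card_complete_graph_le_colors[OF assms] n by linarith
  ultimately have "1 \<in> (\<Union>v \<in> V. g v ` V)" "t \<in> (\<Union>v \<in> V. g v ` V)"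
    unfolding colors by auto
  then obtain u v where uv: "u \<in> V" "1 \<in> g u ` V" "v \<in> V" "t \<in> g v ` V"
    by blast
  \<comment> \<open>The entry \<open>g u v = g v u\<close> links the row containing color 1 to the
    row containing color \<open>t\<close>.\<close>
  have "g u v \<le> 1 + (card V - 1)"
    using uv by (intro close[of u]) auto
  moreover have "t \<le> g v u + (card V - 1)"
    using uv by (intro close[of v]) auto
  ultimately show ?thesis
    using n color_matrix_commute[of c u v] unfolding g_def by linarith
qed

text \<open>If \<open>x\<close> had color \<open>a\<close>, no other vertex and no edge at
  \<open>x\<close> could have it. The edges of color \<open>a\<close> would then match up the
  vertices of \<open>V - {x}\<close>, an odd number.\<close>

lemma common_color_not_vertex_color:
  assumes fin: "finite V" and "even (card V)"
    and tc: "total_coloring (complete_graph V) c"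
    and common: "\<And>v. v \<in> V \<Longrightarrow> a \<in> color_matrix c v ` V"
    and x: "x \<in> V"
  shows "c (Inl x) \<noteq> a"
proof
  assume a: "c (Inl x) = a"
  define M where "M = {e \<in> edges (complete_graph V). c (Inr e) = a}"
  have edge: "e \<subseteq> V \<and> card e = 2" if "e \<in> M" for e
    using that simple_complete_graph[OF fin] by (simp add: M_def simple_graph_def)
  have "\<Union>M = V - {x}"
  proof (intro equalityI subsetI)
    fix v assume "v \<in> \<Union>M"
    then obtain e where "e \<in> M" "v \<in> e"
      by blast
    then show "v \<in> V - {x}"
      using edge[of e] total_coloring_vertex_edge[OF tc, of x e] x a by (auto simp: M_def)
  next
    fix v assume v: "v \<in> V - {x}"
    then obtain w where w: "w \<in> V" "color_matrix c v w = a"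
      using common[of v] by auto
    \<comment> \<open>Since \<open>x\<close> already carries \<open>a\<close> on the diagonal, the
      occurrence of \<open>a\<close> in row \<open>v\<close> is off the diagonal, hence an
      edge.\<close>
    have "inj_on (\<lambda>v. color_matrix c v v) V" "color_matrix c x x = a"
      using tc a unfolding total_coloring_complete_graph_iff by (simp_all add: color_matrix_def)
    then have "v \<noteq> w"
      using v w x by (auto dest: inj_onD)
    then have "{v, w} \<in> M"
      using v w by (auto simp: M_def color_matrix_def edge_complete_graph_iff)
    then show "v \<in> \<Union>M" by blast
  qed
  moreover have "2 * card M = card (\<Union>M)"
  proof (rule card_partition)
    show fU: "finite (\<Union>M)"
      using edge fin by (metis Sup_le_iff finite_subset)
    then show "finite M"
      by (rule finite_UnionD)
    show "card e = 2" if "e \<in> M" for e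
      using edge[OF that] by simp
    show "e \<inter> e' = {}" if "e \<in> M" "e' \<in> M" "e \<noteq> e'" for e e'
      using that total_coloring_edges[OF tc, of e e'] by (auto simp: M_def)
  qed
  ultimately have "2 * card M = card V - 1"
    using fin x by simp
  moreover have "card V > 0"
    using fin x by (auto simp: card_gt_0_iff)
  ultimately show False
    using \<open>even (card V)\<close> by presburger
qed

lemma even_complete_graph_colors_ge:
  assumes "finite V" "V \<noteq> {}" "even (card V)" "interval_total_coloring (complete_graph V) t c"
  shows "3 * card V \<le> 2 * t"
proof -
  define n where "n = card V"
  have n: "n > 0"
    using assms by (simp add: card_gt_0_iff n_def)
  have nt: "n \<le> t"
    using card_complete_graph_le_colors[OF assms(1,2,4)] by (simp add: n_def)
  have diag: "inj_on (\<lambda>v. color_matrix c v v) V"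
    and colors: "(\<Union>v \<in> V. color_matrix c v ` V) = {1..t}"
    and rows: "\<And>v. v \<in> V \<Longrightarrow> \<exists>k. color_matrix c v ` V = {k..k + (n - 1)}"
    using assms(4) unfolding interval_total_coloring_complete_graph_iff n_def by auto
  \<comment> \<open>A row starts at some \<open>k\<close> with
    \<open>1 \<le> k \<le> t - n + 1\<close>, so it has begun by \<open>t - n + 1\<close> and does
    not end before \<open>n\<close>.\<close>
  have common: "{t - n + 1..n} \<subseteq> color_matrix c v ` V" if v: "v \<in> V" for v
  proof -
    obtain k where k: "color_matrix c v ` V = {k..k + (n - 1)}"
      using rows[OF v] by blast
    then have "{k..k + (n - 1)} \<subseteq> {1..t}"
      using colors v by blast
    then have "1 \<le> k" "k + (n - 1) \<le> t"
      by auto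
    then show ?thesis
      unfolding k using n by auto
  qed
  have tc: "total_coloring (complete_graph V) c"
    using assms(4) by (simp add: interval_total_coloring_def)
  have "color_matrix c v v \<in> {1..t - n} \<union> {n + 1..t}" if v: "v \<in> V" for v
  proof -
    have "color_matrix c v v \<in> {1..t}"
      using colors v by blast
    moreover have "c (Inl v) \<notin> {t - n + 1..n}"
      using common_color_not_vertex_color[OF assms(1,3) tc _ v] common by blast
    ultimately show ?thesis
      by (auto simp: color_matrix_def)
  qed
  then have "(\<lambda>v. color_matrix c v v) ` V \<subseteq> {1..t - n} \<union> {n + 1..t}"
    by blast
  then have "n \<le> card ({1..t - n} \<union> {n + 1..t})"
    unfolding n_def by (intro card_inj_on_le[OF diag]) auto
  \<comment> \<open>The two ranges may overlap for large \<open>t\<close>, hence only an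
    inequality.\<close>
  also have "\<dots> \<le> (t - n) + (t - n)"
    using card_Un_le[of "{1..t - n}" "{n + 1..t}"] by simp
  finally show ?thesis
    using nt by (simp add: n_def)
qed

section \<open>Values of the two parameters\<close>

theorem theorem10:
  fixes n :: nat and V :: "'a set"
  assumes "n \<ge> 1" and "finite V" and "card V = n"
  shows "complete_graph V \<in> interval_total_colorable \<and>
    (odd n \<longrightarrow> w_tau (complete_graph V) = n) \<and>
    (even n \<longrightarrow> real (w_tau (complete_graph V)) = 3 / 2 * real n) \<and>
    W_tau (complete_graph V) = 2 * n - 1"
proof (intro conjI impI)
  have ne: "V \<noteq> {}"
    using assms by auto
  note max = complete_graph_colorable_max[OF assms(2,3,1)]
  show "complete_graph V \<in> interval_total_colorable"
    using max assms(1) unfolding interval_total_colorable_def by force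
  show "W_tau (complete_graph V) = 2 * n - 1"
    unfolding W_tau_def
  proof (rule Greatest_equality)
    show "t \<le> 2 * n - 1" if "1 \<le> t \<and> complete_graph V \<in> interval_total_colorable_with t" for t
      using that complete_graph_colors_le[OF assms(2) ne] assms(3)
      by (auto simp: interval_total_colorable_with_def)
  qed (use max assms(1) in auto)
  show "w_tau (complete_graph V) = n" if "odd n"
    unfolding w_tau_def
  proof (rule Least_equality)
    show "n \<le> t" if "1 \<le> t \<and> complete_graph V \<in> interval_total_colorable_with t" for t
      using that card_complete_graph_le_colors[OF assms(2) ne] assms(3)
      by (auto simp: interval_total_colorable_with_def)
  qed (use complete_graph_colorable_odd[OF assms(2,3) that] assms(1) in auto)
  show "real (w_tau (complete_graph V)) = 3 / 2 * real n" if even: "even n"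
  proof -
    obtain m where m: "n = 2 * m"
      using even by blast
    \<comment> \<open>Writing \<open>n = 2 * m\<close> keeps the value a natural number, and the
      lower bound \<open>3 * n \<le> 2 * t\<close> becomes \<open>3 * m \<le> t\<close>.\<close>
    have "w_tau (complete_graph V) = 3 * m"
      unfolding w_tau_def
    proof (rule Least_equality)
      show "3 * m \<le> t" if "1 \<le> t \<and> complete_graph V \<in> interval_total_colorable_with t" for t
        using that even_complete_graph_colors_ge[OF assms(2) ne] assms(3) m
        by (auto simp: interval_total_colorable_with_def)
    qed (use complete_graph_colorable_even[of V m] assms m in auto)
    then show ?thesis
      using m by simp
  qed
qed

end
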